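(* Let $\lambda,\mu,\alpha,\beta>0$ satisfy $\lambda<\frac{\beta}{\alpha+\beta}\mu$, and let $\pi$ be the stationary distribution of Model 1 (the unreliable $M/M/1$ server). Then, as $k\to\infty$, $$\pi(k,U)\sim C^{(1)}(U)\,\gamma_1^k,\qquad \pi(k,D)\sim C^{(1)}(D)\,\gamma_1^k,$$ where $$C^{(1)}(U)=\frac{\eta^{(1)}}{\tilde d^{(1)}}\cdot\frac1G\cdot\frac{\lambda+\beta-\mu-\alpha+\sqrt{s_1}}{2}\neq 0,\qquad C^{(1)}(D)=\frac{\eta^{(1)}}{\tilde d^{(1)}}\cdot\frac{\alpha}{G}\neq 0 .$$
   Context: Notation: $n_k\sim m_k$ means $n_k/m_k\to1$ as $k\to\infty$; $\mathbb N=\{0,1,2,\dots\}$; $U$ = Up, $D$ = Down. Model 1: the continuous-time Markov chain on $\mathbb N\times\{U,D\}$ (number of customers, server status) with transition intensities: $(x,\sigma)\to(x+1,\sigma)$ at rate $\lambda$ for all $x\ge 0$, $\sigma\in\{U,D\}$; $(x,U)\to(x-1,U)$ at rate $\mu$ for $x\ge1$; $(x,U)\to(x,D)$ at rate $\alpha$ and $(x,D)\to(x,U)$ at rate $\beta$ for all $x\ge0$. Under $\lambda<\frac{\beta}{\alpha+\beta}\mu$ it has a unique stationary distribution $\pi$. Constants: $$s_1=(\mu-\lambda-\beta-\alpha)^2+4\alpha\mu,\qquad \gamma_1=\frac{2\lambda}{\lambda+\beta+\mu+\alpha-\sqrt{s_1}}\in(0,1),$$ $$G=\frac{\lambda+\beta-\mu-\alpha+\sqrt{s_1}}{2}+\frac{2\alpha\beta}{\lambda+\beta-\mu-\alpha+\sqrt{s_1}}.$$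 Fix a uniformization constant $C\ge\lambda+\mu+\alpha+\beta$ and put $$\tilde d^{(1)}=\frac1C\left(\frac{\lambda+\beta+\mu+\alpha-\sqrt{s_1}}{2}-\frac1G\,\lambda\mu\,\frac{\lambda+\beta-\mu-\alpha+\sqrt{s_1}}{\lambda+\beta+\mu+\alpha-\sqrt{s_1}}\right).$$ Definition of $\eta^{(1)}$: let $\mathbf K^\infty$ be the kernel on $\mathbb Z\times\{U,D\}$ (the free process), shift invariant in the first coordinate, with $\mathbf K^\infty((m,\sigma),(m+1,\sigma))=\lambda/C$ for $\sigma\in\{U,D\}$, $\mathbf K^\infty((m,U),(m-1,U))=\mu/C$, $\mathbf K^\infty((m,U),(m,D))=\alpha/C$, $\mathbf K^\infty((m,D),(m,U))=\beta/C$, $\mathbf K^\infty((m,D),(m,D))=1-\frac{\lambda+\beta}{C}$, $\mathbf K^\infty((m,U),(m,U))=1-\frac{\lambda+\mu+\alpha}{C}$. Let $h(x,U)=\gamma_1^{-x}$ and $h(x,D)=\gamma_1^{-x}\,\frac{2\beta}{\lambda+\beta-\mu-\alpha+\sqrt{s_1}}$, and let the twisted free process be the discrete-time Markov chain with transition kernel $\mathcal K(z,z')=\mathbf K^\infty(z,z')h(z')/h(z)$. Then $$\eta^{(1)}=\sum_{\sigma\in\{U,D\}}\pi(0,\sigma)\,h(0,\sigma)\,\mathcal H(0,\sigma),$$ where $\mathcal H(0,\sigma)$ is the probability that the twisted free process started at $(0,\sigma)$ has strictly positive first coordinate at all times $n\ge1$. *)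

theory Defs
  imports "HOL-Probability.Probability" "HOL-Library.Landau_Symbols"
begin

section \<open>Continuous-time chains given by transition intensities\<close>

text \<open>
  \<open>q z z'\<close> is the intensity of the jump from \<open>z\<close> to \<open>z'\<close> (zero on the diagonal). For intensities with
  bounded total rate, as below, stationarity of a distribution under the transition semigroup
  amounts to the equations \<open>\<pi> Q = 0\<close>, here written as balance of inflow and outflow at each state.
\<close>

definition stationary_distribution :: "('a \<Rightarrow> 'a \<Rightarrow> real) \<Rightarrow> 'a pmf \<Rightarrow> bool" where
  "stationary_distribution q \<pi> \<longleftrightarrow>
     (\<forall>z. ((\<lambda>z'. pmf \<pi> z' * q z' z) has_sum (pmf \<pi> z * (\<Sum>\<^sub>\<infinity>z'. q z z'))) UNIV)"


section \<open>Path law of a discrete-time Markov chain\<close>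

text \<open>
  The law on path space of the chain with transition kernel \<open>K\<close> started at \<open>z0\<close>, obtained
  from the Ionescu-Tulcea extension. It is meaningful when \<open>K\<close> is a stochastic matrix (for the kernel used
  below, see \<open>stochastic_kernel_twisted\<close>); \<open>chain_law_cylinder\<close> then identifies its
  finite-dimensional distributions.
\<close>

definition step_law :: "('a \<Rightarrow> 'a \<Rightarrow> real) \<Rightarrow> 'a \<Rightarrow> 'a measure" where
  "step_law K z = density (count_space UNIV) (\<lambda>z'. ennreal (K z z'))"

definition next_law :: "('a \<Rightarrow> 'a \<Rightarrow> real) \<Rightarrow> 'a \<Rightarrow> nat \<Rightarrow> (nat \<Rightarrow> 'a) \<Rightarrow> 'a measure" where
  "next_law K z0 n \<omega> =
     (if n = 0 then return (count_space UNIV) z0 else step_law K (\<omega> (n - 1)))"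

definition chain_law :: "('a \<Rightarrow> 'a \<Rightarrow> real) \<Rightarrow> 'a \<Rightarrow> (nat \<Rightarrow> 'a) measure" where
  "chain_law K z0 =
     projective_family.lim UNIV
       (Ionescu_Tulcea.CI (next_law K z0) (\<lambda>_. count_space UNIV)) (\<lambda>_. count_space UNIV)"

definition stochastic_kernel :: "('a \<Rightarrow> 'a \<Rightarrow> real) \<Rightarrow> bool" where
  "stochastic_kernel K \<longleftrightarrow> (\<forall>z. (\<forall>z'. 0 \<le> K z z') \<and> (K z has_sum 1) UNIV)"

lemma prob_space_step_law:
  assumes "stochastic_kernel K"
  shows "prob_space (step_law K z)"
proof
  have nonneg: "0 \<le> K z z'" for z'
    using assms by (simp add: stochastic_kernel_def)
  have hs: "(K z has_sum 1) UNIV"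
    using assms by (simp add: stochastic_kernel_def)
  then have "Infinite_Set_Sum.abs_summable_on (K z) UNIV"
    using nonneg by (subst abs_summable_equivalent[symmetric]) (simp add: has_sum_imp_summable)
  then have "integral\<^sup>N (count_space UNIV) (\<lambda>z'. ennreal (K z z')) = 1"
    using nonneg hs
    by (simp add: nn_integral_conv_infsetsum infsetsum_infsum infsumI)
  then show "emeasure (step_law K z) (space (step_law K z)) = 1"
    by (simp add: step_law_def emeasure_density)
qed

lemma Ionescu_Tulcea_next_law:
  assumes "stochastic_kernel K"
  shows "Ionescu_Tulcea (next_law K z0) (\<lambda>_. count_space UNIV)"
proof (rule Ionescu_Tulcea.intro)
  show "prob_space (next_law K z0 i x)" for i x
    using prob_space_step_law[OF assms] by (auto simp: next_law_def intro!: prob_space_return)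
  have step: "step_law K \<in> measurable (count_space UNIV) (subprob_algebra (count_space UNIV))"
    using prob_space_step_law[OF assms]
    by (auto simp: space_subprob_algebra step_law_def prob_space_imp_subprob_space)
  show "next_law K z0 i \<in>
      measurable (PiM {0..<i} (\<lambda>_. count_space UNIV)) (subprob_algebra (count_space UNIV))" for i
  proof (cases i)
    case 0
    then show ?thesis
      by (auto simp: next_law_def[abs_def] space_subprob_algebra
               intro!: measurable_const prob_space_imp_subprob_space prob_space_return)
  next
    case (Suc n)
    have "(\<lambda>\<omega>. \<omega> n) \<in> measurable (PiM {0..<i} (\<lambda>_. count_space UNIV)) (count_space UNIV)"
      using Suc by (intro measurable_component_singleton) auto
    from measurable_compose[OF this step] Suc show ?thesis
      by (simp add: next_law_def[abs_def])
  qed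
qed

lemma prob_space_chain_law:
  assumes "stochastic_kernel K"
  shows "prob_space (chain_law K z0)"
proof -
  interpret IT: Ionescu_Tulcea "next_law K z0" "\<lambda>_. count_space UNIV"
    by (rule Ionescu_Tulcea_next_law[OF assms])
  have "emeasure IT.PF.lim (IT.PF.emb UNIV {} {\<lambda>x. undefined}) = emeasure (IT.CI {}) {\<lambda>x. undefined}"
    by (rule IT.lim) (auto simp: PiM_empty)
  also have "\<dots> = 1"
    using prob_space.emeasure_space_1[OF IT.PF.prob_space_P[of "{}"]]
    by (simp add: IT.PF.space_P space_PiM PiE_empty_domain)
  finally have "emeasure IT.PF.lim (IT.PF.emb UNIV {} {\<lambda>x. undefined}) = 1" .
  moreover have "IT.PF.emb UNIV {} {\<lambda>x. undefined} = UNIV"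
    by (auto simp: prod_emb_def restrict_def)
  ultimately have "emeasure IT.PF.lim UNIV = 1"
    by metis
  then show ?thesis
    unfolding chain_law_def
    by (intro prob_spaceI) (simp add: space_PiM PiE_UNIV_domain)
qed

lemma chain_law_cylinder:
  assumes "stochastic_kernel K"
  shows "measure (chain_law K z0) {\<omega>. \<forall>i\<le>n. \<omega> i = p i} =
           (if p 0 = z0 then \<Prod>i<n. K (p i) (p (Suc i)) else 0)"
proof -
  let ?M = "\<lambda>_. count_space UNIV"
  interpret IT: Ionescu_Tulcea "next_law K z0" ?M
    by (rule Ionescu_Tulcea_next_law[OF assms])
  let ?R = "\<lambda>n. restrict p {0..<n}"
  have nonneg: "0 \<le> K z z'" for z z'
    using assms by (simp add: stochastic_kernel_def)
  have single: "{?R n} \<in> sets (PiM {0..<n} ?M)" for n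
  proof -
    have "{?R n} = PiE {0..<n} (\<lambda>i. {p i})"
      using PiE_singleton[of "?R n" "{0..<n}"] PiE_cong[of "{0..<n}" "\<lambda>i. {?R n i}" "\<lambda>i. {p i}"]
      by simp
    then show ?thesis by (auto intro!: sets_PiM_I_finite)
  qed
  have C: "emeasure (IT.C 0 (Suc n) (\<lambda>_. undefined)) {?R (Suc n)} =
      ennreal (if p 0 = z0 then \<Prod>i<n. K (p i) (p (Suc i)) else 0)" for n
  proof -
    have rec: "emeasure (IT.C 0 (Suc n) (\<lambda>_. undefined)) {?R (Suc n)} =
        emeasure (next_law K z0 n (?R n)) {p n} * emeasure (IT.C 0 n (\<lambda>_. undefined)) {?R n}" for n
    proof -
      have sp: "(\<lambda>_. undefined) \<in> space (PiM {0..<0::nat} ?M)"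
        by (simp add: space_PiM)
      have eP: "emeasure (IT.eP n \<omega>) {?R (Suc n)} =
          emeasure (next_law K z0 n (?R n)) {p n} * indicator {?R n} \<omega>"
        if w: "\<omega> \<in> space (PiM {0..<n} ?M)" for \<omega>
      proof -
        have vim: "(\<lambda>x. fun_upd \<omega> n x) -` {?R (Suc n)} = (if \<omega> = ?R n then {p n} else {})"
        proof -
          have key: "fun_upd \<omega> n x = ?R (Suc n) \<longleftrightarrow> x = p n \<and> \<omega> = ?R n" for x
          proof
            assume eq: "fun_upd \<omega> n x = ?R (Suc n)"
            have "x = p n" using fun_cong[OF eq, of n] by simp
            moreover have "\<omega> i = ?R n i" for i
              using fun_cong[OF eq, of i] w
              by (cases "i < n"; cases "i = n") (auto simp: space_PiM PiE_def extensional_def)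
            ultimately show "x = p n \<and> \<omega> = ?R n"
              using ext[of \<omega> "?R n"] by blast
          next
            assume "x = p n \<and> \<omega> = ?R n"
            then show "fun_upd \<omega> n x = ?R (Suc n)" by (auto simp: restrict_def less_Suc_eq)
          qed
          show ?thesis
            by (rule set_eqI) (simp only: vimage_eq key singleton_iff empty_iff split: if_split, blast)
        qed
        show ?thesis
          unfolding IT.emeasure_eP[OF w single] vim by (simp add: indicator_def)
      qed
      have "emeasure (IT.C 0 (Suc n) (\<lambda>_. undefined)) {?R (Suc n)} =
          (\<integral>\<^sup>+\<omega>. emeasure (IT.eP n \<omega>) {?R (Suc n)} \<partial>IT.C 0 n (\<lambda>_. undefined))"
        unfolding IT.C.simps add_0
      proof (rule emeasure_bind[where N="PiM {0..<Suc n} ?M"])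
        show "space (IT.C 0 n (\<lambda>_. undefined)) \<noteq> {}"
          using IT.space_C[OF sp, of n] by simp
        show "IT.eP n \<in> measurable (IT.C 0 n (\<lambda>_. undefined)) (subprob_algebra (PiM {0..<Suc n} ?M))"
          unfolding measurable_cong_sets[OF IT.sets_C[OF sp, of n, unfolded add_0] refl]
          by (rule IT.measurable_eP)
        show "{?R (Suc n)} \<in> sets (PiM {0..<Suc n} ?M)"
          by (rule single)
      qed
      also have "\<dots> = (\<integral>\<^sup>+\<omega>. emeasure (next_law K z0 n (?R n)) {p n} * indicator {?R n} \<omega>
           \<partial>IT.C 0 n (\<lambda>_. undefined))"
        using IT.space_C[OF sp, of n] by (intro nn_integral_cong eP) simp
      also have "\<dots> = emeasure (next_law K z0 n (?R n)) {p n} *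
          emeasure (IT.C 0 n (\<lambda>_. undefined)) {?R n}"
        using single[of n] IT.sets_C[OF sp, of n] by (subst nn_integral_cmult_indicator) simp_all
      finally show ?thesis .
    qed
    show ?thesis
    proof (induction n)
      case 0
      have "?R 0 = (\<lambda>_. undefined)"
        by (auto simp: restrict_def)
      then show ?case
        by (subst rec) (auto simp: next_law_def PiM_empty split: split_indicator)
    next
      case (Suc n)
      have "emeasure (step_law K z) {z'} = ennreal (K z z')" for z z'
        by (simp add: step_law_def emeasure_density nn_integral_count_space_indicator[symmetric])
      then have "emeasure (next_law K z0 (Suc n) (?R (Suc n))) {p (Suc n)} =
          ennreal (K (p n) (p (Suc n)))"
        by (simp add: next_law_def)
      then show ?case
        unfolding rec[of "Suc n"] Suc.IH
        using nonneg by (simp add: ennreal_mult'[symmetric] mult.commute)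
    qed
  qed
  have "{\<omega>. \<forall>i\<le>n. \<omega> i = p i} = IT.PF.emb UNIV {0..<Suc n} {?R (Suc n)}"
    by (auto simp: prod_emb_def fun_eq_iff restrict_def less_Suc_eq_le) (metis (full_types))
  then have "emeasure (chain_law K z0) {\<omega>. \<forall>i\<le>n. \<omega> i = p i} =
      emeasure (IT.CI {0..<Suc n}) {?R (Suc n)}"
    using IT.lim[OF _ single[of "Suc n"]] by (simp add: chain_law_def)
  also have "\<dots> = emeasure (IT.C 0 (Suc n) (\<lambda>_. undefined)) {?R (Suc n)}"
    using IT.emeasure_CI[OF order_refl single[of "Suc n"]] single[of "Suc n"]
    by (simp add: prod_emb_id sets.sets_into_space[THEN subset_trans] space_PiM PiE_iff
             del: IT.C.simps)
  finally show ?thesis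
    unfolding C using nonneg by (simp add: measure_def prod_nonneg)
qed


section \<open>The unreliable M/M/1 server\<close>

datatype server = Up | Down

fun rate :: "real \<Rightarrow> real \<Rightarrow> real \<Rightarrow> real \<Rightarrow> nat \<times> server \<Rightarrow> nat \<times> server \<Rightarrow> real" where
  "rate lam \<mu> \<alpha> \<beta> (x, s) (y, t) =
     (if y = x + 1 \<and> t = s then lam
      else if x = y + 1 \<and> s = Up \<and> t = Up then \<mu>
      else if y = x \<and> s = Up \<and> t = Down then \<alpha>
      else if y = x \<and> s = Down \<and> t = Up then \<beta>
      else 0)"

definition s1 :: "real \<Rightarrow> real \<Rightarrow> real \<Rightarrow> real \<Rightarrow> real" where
  "s1 lam \<mu> \<alpha> \<beta> = (\<mu> - lam - \<beta> - \<alpha>)\<^sup>2 + 4 * \<alpha> * \<mu>"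

definition gamma1 :: "real \<Rightarrow> real \<Rightarrow> real \<Rightarrow> real \<Rightarrow> real" where
  "gamma1 lam \<mu> \<alpha> \<beta> = 2 * lam / (lam + \<beta> + \<mu> + \<alpha> - sqrt (s1 lam \<mu> \<alpha> \<beta>))"

definition G1 :: "real \<Rightarrow> real \<Rightarrow> real \<Rightarrow> real \<Rightarrow> real" where
  "G1 lam \<mu> \<alpha> \<beta> = (lam + \<beta> - \<mu> - \<alpha> + sqrt (s1 lam \<mu> \<alpha> \<beta>)) / 2
     + 2 * \<alpha> * \<beta> / (lam + \<beta> - \<mu> - \<alpha> + sqrt (s1 lam \<mu> \<alpha> \<beta>))"

definition d1 :: "real \<Rightarrow> real \<Rightarrow> real \<Rightarrow> real \<Rightarrow> real \<Rightarrow> real" where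
  "d1 C lam \<mu> \<alpha> \<beta> = 1 / C *
     ((lam + \<beta> + \<mu> + \<alpha> - sqrt (s1 lam \<mu> \<alpha> \<beta>)) / 2
      - 1 / G1 lam \<mu> \<alpha> \<beta> * lam * \<mu> *
        ((lam + \<beta> - \<mu> - \<alpha> + sqrt (s1 lam \<mu> \<alpha> \<beta>))
          / (lam + \<beta> + \<mu> + \<alpha> - sqrt (s1 lam \<mu> \<alpha> \<beta>))))"

fun free_kernel ::
    "real \<Rightarrow> real \<Rightarrow> real \<Rightarrow> real \<Rightarrow> real \<Rightarrow> int \<times> server \<Rightarrow> int \<times> server \<Rightarrow> real" where
  "free_kernel C lam \<mu> \<alpha> \<beta> (x, s) (y, t) =
     (if y = x + 1 \<and> t = s then lam / C
      else if y = x - 1 \<and> s = Up \<and> t = Up then \<mu> / C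
      else if y = x \<and> s = Up \<and> t = Down then \<alpha> / C
      else if y = x \<and> s = Down \<and> t = Up then \<beta> / C
      else if y = x \<and> s = Down \<and> t = Down then 1 - (lam + \<beta>) / C
      else if y = x \<and> s = Up \<and> t = Up then 1 - (lam + \<mu> + \<alpha>) / C
      else 0)"

fun h1 :: "real \<Rightarrow> real \<Rightarrow> real \<Rightarrow> real \<Rightarrow> int \<times> server \<Rightarrow> real" where
  "h1 lam \<mu> \<alpha> \<beta> (x, Up) = gamma1 lam \<mu> \<alpha> \<beta> powi (- x)"
| "h1 lam \<mu> \<alpha> \<beta> (x, Down) =
     gamma1 lam \<mu> \<alpha> \<beta> powi (- x) * (2 * \<beta> / (lam + \<beta> - \<mu> - \<alpha> + sqrt (s1 lam \<mu> \<alpha> \<beta>)))"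

definition twisted_kernel ::
    "real \<Rightarrow> real \<Rightarrow> real \<Rightarrow> real \<Rightarrow> real \<Rightarrow> int \<times> server \<Rightarrow> int \<times> server \<Rightarrow> real" where
  "twisted_kernel C lam \<mu> \<alpha> \<beta> z z' =
     free_kernel C lam \<mu> \<alpha> \<beta> z z' * h1 lam \<mu> \<alpha> \<beta> z' / h1 lam \<mu> \<alpha> \<beta> z"

lemma has_sum_server:
  fixes f :: "int \<times> server \<Rightarrow> real"
  assumes "\<And>y t. \<bar>y - x\<bar> > 1 \<Longrightarrow> f (y, t) = 0"
  shows "(f has_sum (f (x - 1, Up) + f (x - 1, Down) + f (x, Up) + f (x, Down)
           + f (x + 1, Up) + f (x + 1, Down))) UNIV"
proof -
  let ?F = "{(x - 1, Up), (x - 1, Down), (x, Up), (x, Down), (x + 1, Up), (x + 1, Down)}"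
  have "(f has_sum (sum f ?F)) UNIV"
  proof (rule has_sum_finite_neutralI)
    show "f z = 0" if "z \<in> UNIV - ?F" for z
    proof (cases z)
      case (Pair y t)
      with that have "\<bar>y - x\<bar> > 1" by (cases t) auto
      with assms Pair show ?thesis by simp
    qed
  qed auto
  then show ?thesis by (simp add: algebra_simps)
qed

lemma stochastic_kernel_twisted:
  assumes pos: "lam > 0" "\<mu> > 0" "\<alpha> > 0" "\<beta> > 0" and C: "C \<ge> lam + \<mu> + \<alpha> + \<beta>"
  shows "stochastic_kernel (twisted_kernel C lam \<mu> \<alpha> \<beta>)"
proof -
  define t where "t = sqrt (s1 lam \<mu> \<alpha> \<beta>)"
  define g where "g = gamma1 lam \<mu> \<alpha> \<beta>"
  define r where "r = 2 * \<beta> / (lam + \<beta> - \<mu> - \<alpha> + t)"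
  have "s1 lam \<mu> \<alpha> \<beta> \<ge> 0" using pos by (simp add: s1_def)
  then have t2: "t\<^sup>2 = (\<mu> - lam - \<beta> - \<alpha>)\<^sup>2 + 4 * \<alpha> * \<mu>"
    by (simp add: t_def s1_def)
  have t0: "t \<ge> 0" using \<open>s1 lam \<mu> \<alpha> \<beta> \<ge> 0\<close> by (simp add: t_def)
  have e1: "(lam + \<beta> + \<mu> + \<alpha> - t) * (lam + \<beta> + \<mu> + \<alpha> + t) = 4 * \<mu> * (lam + \<beta>)"
    using t2 by (simp add: power2_eq_square algebra_simps)
  have e2: "(t - (lam + \<beta> - \<mu> - \<alpha>)) * (lam + \<beta> - \<mu> - \<alpha> + t) = 4 * \<alpha> * (lam + \<beta>)"
    using t2 by (simp add: power2_eq_square algebra_simps)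
  have d: "lam + \<beta> + \<mu> + \<alpha> - t > 0"
    using e1 pos t0 by (smt (verit) mult_pos_pos zero_less_mult_pos2)
  have "\<bar>lam + \<beta> - \<mu> - \<alpha>\<bar> < t"
  proof (rule power2_less_imp_less[OF _ t0])
    have "\<alpha> * (lam + \<beta>) > 0" using pos by simp
    then show "\<bar>lam + \<beta> - \<mu> - \<alpha>\<bar>\<^sup>2 < t\<^sup>2"
      using e2 by (simp add: power2_eq_square algebra_simps)
  qed
  then have w: "lam + \<beta> - \<mu> - \<alpha> + t > 0" by linarith
  have g: "g > 0" "lam / g = (lam + \<beta> + \<mu> + \<alpha> - t) / 2"
    and gd: "g = 2 * lam / (lam + \<beta> + \<mu> + \<alpha> - t)"
    using pos d by (simp_all add: g_def gamma1_def t_def[symmetric])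
  have r: "r > 0" "\<beta> / r = (lam + \<beta> - \<mu> - \<alpha> + t) / 2"
    using pos w by (simp_all add: r_def)
  have mg: "\<mu> * g = lam * (lam + \<beta> + \<mu> + \<alpha> + t) / (2 * (lam + \<beta>))"
  proof -
    have "2 * lam * (2 * (lam + \<beta>) * \<mu>) = lam * ((lam + \<beta> + \<mu> + \<alpha> + t) * (lam + \<beta> + \<mu> + \<alpha> - t))"
      using e1 by (simp add: ac_simps)
    then show ?thesis
      using d pos by (simp add: gd frac_eq_eq mult.assoc mult.commute mult.left_commute)
  qed
  have ar: "\<alpha> * r = \<beta> * (t - (lam + \<beta> - \<mu> - \<alpha>)) / (2 * (lam + \<beta>))"
  proof -
    have "2 * \<beta> * \<alpha> * (2 * (lam + \<beta>)) = \<beta> * ((t - (lam + \<beta> - \<mu> - \<alpha>)) * (lam + \<beta> - \<mu> - \<alpha> + t))"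
      using e2 by (simp add: ac_simps)
    then show ?thesis
      using w pos by (simp add: r_def frac_eq_eq mult.assoc mult.commute mult.left_commute)
  qed
  have D: "lam / g + \<beta> / r = lam + \<beta>"
    by (simp add: g r field_simps)
  have U: "lam / g + \<mu> * g + \<alpha> * r = lam + \<mu> + \<alpha>"
  proof -
    have "\<mu> * g + \<alpha> * r = (lam * (lam + \<beta> + \<mu> + \<alpha> + t) + \<beta> * (t - (lam + \<beta> - \<mu> - \<alpha>))) / (2 * (lam + \<beta>))"
      by (simp add: mg ar add_divide_distrib)
    also have "lam * (lam + \<beta> + \<mu> + \<alpha> + t) + \<beta> * (t - (lam + \<beta> - \<mu> - \<alpha>)) = (lam - \<beta> + \<mu> + \<alpha> + t) * (lam + \<beta>)"
      by (simp add: algebra_simps)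
    also have "\<dots> / (2 * (lam + \<beta>)) = (lam - \<beta> + \<mu> + \<alpha> + t) / 2"
      using pos by (intro nonzero_mult_divide_mult_cancel_right) simp
    finally show ?thesis by (simp add: g field_simps)
  qed
  have h: "h1 lam \<mu> \<alpha> \<beta> (x, Up) = g powi (- x)" "h1 lam \<mu> \<alpha> \<beta> (x, Down) = g powi (- x) * r" for x
    by (simp_all add: g_def r_def t_def)
  have h_pos: "h1 lam \<mu> \<alpha> \<beta> z > 0" for z
    using g r by (cases z; cases "snd z") (auto simp: h simp del: h1.simps)
  have C0: "C > 0" using pos C by linarith
  have "0 \<le> free_kernel C lam \<mu> \<alpha> \<beta> z z'" for z z'
    using pos C C0 by (cases z; cases z') simp
  then have nonneg: "0 \<le> twisted_kernel C lam \<mu> \<alpha> \<beta> z z'" for z z'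
    using h_pos[of z] h_pos[of z'] by (simp add: twisted_kernel_def)
  have "(twisted_kernel C lam \<mu> \<alpha> \<beta> (x, s) has_sum 1) UNIV" for x s
  proof -
    let ?K = "twisted_kernel C lam \<mu> \<alpha> \<beta> (x, s)"
    have step: "g powi (- (x + 1)) = g powi (- x) / g" "g powi (- (x - 1)) = g powi (- x) * g"
      using g by (simp_all add: power_int_diff power_int_add power_int_minus field_simps)
    have up: "h1 lam \<mu> \<alpha> \<beta> (x + 1, s) = h1 lam \<mu> \<alpha> \<beta> (x, s) / g" for s
      by (cases s; simp only: h step times_divide_eq_left)
    have dn: "h1 lam \<mu> \<alpha> \<beta> (x - 1, s) = h1 lam \<mu> \<alpha> \<beta> (x, s) * g" for s
      by (cases s; simp only: h step mult.assoc mult.commute[of g r])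
    have "h1 lam \<mu> \<alpha> \<beta> (x, Down) = h1 lam \<mu> \<alpha> \<beta> (x, Up) * r"
      by (simp only: h)
    note hs = up dn this
    have nz: "h1 lam \<mu> \<alpha> \<beta> (x, Up) \<noteq> 0" "r \<noteq> 0"
      using h_pos[of "(x, Up)"] r(1) by (simp_all del: h1.simps)
    have "?K (x - 1, Up) + ?K (x - 1, Down) + ?K (x, Up) + ?K (x, Down)
           + ?K (x + 1, Up) + ?K (x + 1, Down) = 1"
    proof (cases s)
      case Up
      have "?K (x - 1, Up) + ?K (x - 1, Down) + ?K (x, Up) + ?K (x, Down)
           + ?K (x + 1, Up) + ?K (x + 1, Down)
         = (lam / g + \<mu> * g + \<alpha> * r) / C + (1 - (lam + \<mu> + \<alpha>) / C)"
        using nz by (simp add: Up twisted_kernel_def hs add_divide_distrib del: h1.simps)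
      then show ?thesis by (simp add: U)
    next
      case Down
      have "?K (x - 1, Up) + ?K (x - 1, Down) + ?K (x, Up) + ?K (x, Down)
           + ?K (x + 1, Up) + ?K (x + 1, Down)
         = (lam / g + \<beta> / r) / C + (1 - (lam + \<beta>) / C)"
        using nz by (simp add: Down twisted_kernel_def hs add_divide_distrib mult.commute del: h1.simps)
      then show ?thesis by (simp add: D)
    qed
    moreover have "(?K has_sum (?K (x - 1, Up) + ?K (x - 1, Down) + ?K (x, Up) + ?K (x, Down)
           + ?K (x + 1, Up) + ?K (x + 1, Down))) UNIV"
      by (rule has_sum_server) (auto simp: twisted_kernel_def)
    ultimately show ?thesis by simp
  qed
  with nonneg show ?thesis by (auto simp: stochastic_kernel_def)
qed

definition H1 :: "real \<Rightarrow> real \<Rightarrow> real \<Rightarrow> real \<Rightarrow> real \<Rightarrow> server \<Rightarrow> real" where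
  "H1 C lam \<mu> \<alpha> \<beta> s =
     measure (chain_law (twisted_kernel C lam \<mu> \<alpha> \<beta>) (0, s)) {\<omega>. \<forall>n\<ge>1. fst (\<omega> n) > 0}"

definition eta1 ::
    "real \<Rightarrow> real \<Rightarrow> real \<Rightarrow> real \<Rightarrow> real \<Rightarrow> (nat \<times> server) pmf \<Rightarrow> real" where
  "eta1 C lam \<mu> \<alpha> \<beta> \<pi> =
     (\<Sum>s\<in>{Up, Down}. pmf \<pi> (0, s) * h1 lam \<mu> \<alpha> \<beta> (0, s) * H1 C lam \<mu> \<alpha> \<beta> s)"

definition C1 ::
    "real \<Rightarrow> real \<Rightarrow> real \<Rightarrow> real \<Rightarrow> real \<Rightarrow> (nat \<times> server) pmf \<Rightarrow> server \<Rightarrow> real" where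
  "C1 C lam \<mu> \<alpha> \<beta> \<pi> s = eta1 C lam \<mu> \<alpha> \<beta> \<pi> / d1 C lam \<mu> \<alpha> \<beta> *
     (case s of
        Up \<Rightarrow> 1 / G1 lam \<mu> \<alpha> \<beta> * ((lam + \<beta> - \<mu> - \<alpha> + sqrt (s1 lam \<mu> \<alpha> \<beta>)) / 2)
      | Down \<Rightarrow> \<alpha> / G1 lam \<mu> \<alpha> \<beta>)"

end

theory Submission
  imports Defs
begin

text \<open>
  The balance equations give the linear recursion \<open>\<mu> u\<^sub>k\<^sub>+\<^sub>1 = \<lambda> (u\<^sub>k + d\<^sub>k)\<close> (cut equation) and
  \<open>(\<lambda> + \<beta>) d\<^sub>k\<^sub>+\<^sub>1 = \<lambda> d\<^sub>k + \<alpha> u\<^sub>k\<^sub>+\<^sub>1\<close> for \<open>u\<^sub>k = \<pi>(k,U)\<close>, \<open>d\<^sub>k = \<pi>(k,D)\<close>. Its two eigenvalues are \<open>\<gamma>\<^sub>1\<close> and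
  \<open>\<lambda>\<^sup>2 / (\<mu> (\<lambda> + \<beta>) \<gamma>\<^sub>1) < \<gamma>\<^sub>1\<close>, and the constant in front of \<open>\<gamma>\<^sub>1\<^sup>k\<close> is read off the left eigenvector
  \<open>(1 - \<gamma>\<^sub>1, r - \<gamma>\<^sub>1)\<close>, where \<open>r = h(0,D)\<close>. Up to a factor, \<open>\<eta>\<close> is this eigenvector applied to \<open>(u\<^sub>0, d\<^sub>0)\<close>:
  \<open>1/h\<close> is harmonic for the twisted process, equals 1 at \<open>(0,U)\<close>, the only state at level 0 that can be
  entered from above, and vanishes at infinity; by the maximum principle it is the probability of hitting
  level 0, so the escape probability is \<open>1 - 1/h\<close>.
\<close>

section \<open>Probability of staying in a set\<close>

definition stay_prob :: "('a \<Rightarrow> 'a \<Rightarrow> real) \<Rightarrow> 'a set \<Rightarrow> nat \<Rightarrow> 'a \<Rightarrow> real" where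
  "stay_prob K A n z = measure (chain_law K z) {\<omega>. \<forall>i. 1 \<le> i \<and> i \<le> n \<longrightarrow> \<omega> i \<in> A}"

definition escape_prob :: "('a \<Rightarrow> 'a \<Rightarrow> real) \<Rightarrow> 'a set \<Rightarrow> 'a \<Rightarrow> real" where
  "escape_prob K A z = measure (chain_law K z) {\<omega>. \<forall>n\<ge>1. \<omega> n \<in> A}"

text \<open>The backward recursion for \<open>stay_prob\<close>, as \<open>stay_eq_stay_prob\<close>
  shows. Values in \<open>ennreal\<close> let the sum over \<open>A\<close> exist without any
  summability condition.\<close>

primrec stay :: "('a \<Rightarrow> 'a \<Rightarrow> real) \<Rightarrow> 'a set \<Rightarrow> nat \<Rightarrow> 'a \<Rightarrow> ennreal" where
  "stay K A 0 z = 1"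
| "stay K A (Suc n) z = (\<integral>\<^sup>+z'. ennreal (K z z') * stay K A n z' \<partial>count_space A)"

section \<open>Path space: measurable events and the Markov property\<close>

lemma
  assumes "stochastic_kernel K"
  shows space_chain_law: "space (chain_law K z) = UNIV"
    and sets_chain_law: "sets (chain_law K z) = sets (PiM UNIV (\<lambda>_. count_space UNIV))"
proof -
  interpret IT: Ionescu_Tulcea "next_law K z" "\<lambda>_. count_space UNIV"
    by (rule Ionescu_Tulcea_next_law[OF assms])
  show "space (chain_law K z) = UNIV"
    by (simp add: chain_law_def space_PiM PiE_UNIV_domain)
  show "sets (chain_law K z) = sets (PiM UNIV (\<lambda>_. count_space UNIV))"
    by (simp add: chain_law_def)
qed

lemma sets_coordinate:
  assumes "stochastic_kernel K"
  shows "{\<omega>. P (\<omega> i)} \<in> sets (chain_law K z)"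
proof -
  have "(\<lambda>\<omega>. \<omega> i) \<in> measurable (PiM UNIV (\<lambda>_. count_space UNIV)) (count_space UNIV)"
    by (rule measurable_component_singleton) simp
  from measurable_sets[OF this, of "Collect P"] show ?thesis
    by (simp add: vimage_def space_PiM PiE_UNIV_domain sets_chain_law[OF assms])
qed

lemma sets_coordinates:
  assumes "stochastic_kernel K"
  shows "{\<omega>. \<forall>i. Q i \<longrightarrow> P i (\<omega> i)} \<in> sets (chain_law K z)"
proof -
  have "{\<omega> \<in> space (chain_law K z). \<forall>i. Q i \<longrightarrow> P i (\<omega> i)} \<in> sets (chain_law K z)"
  proof (rule sets.sets_Collect_countable_All)
    show "{\<omega> \<in> space (chain_law K z). Q i \<longrightarrow> P i (\<omega> i)} \<in> sets (chain_law K z)" for i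
      using sets_coordinate[OF assms, of "\<lambda>x. Q i \<longrightarrow> P i x" i] by (simp add: space_chain_law[OF assms])
  qed
  then show ?thesis by (simp add: space_chain_law[OF assms])
qed

text \<open>A finite-horizon Markov property drawn from cylinder probabilities alone. Splitting on
  the state at time \<open>Suc m\<close> gives a disjoint union, countable because the state space
  is, of the same events with a cylinder one step longer; hence the induction keeps \<open>m\<close>
  and \<open>p\<close> arbitrary.\<close>

lemma emeasure_cylinder_stay:
  fixes K :: "'a \<Rightarrow> 'a \<Rightarrow> real"
  assumes K: "stochastic_kernel K" and cnt: "countable (UNIV :: 'a set)"
  shows "emeasure (chain_law K z0) {\<omega>. (\<forall>i\<le>m. \<omega> i = p i) \<and> (\<forall>i. m < i \<and> i \<le> m + n \<longrightarrow> \<omega> i \<in> A)}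
       = emeasure (chain_law K z0) {\<omega>. \<forall>i\<le>m. \<omega> i = p i} * stay K A n (p m)"
proof (induction n arbitrary: m p)
  case 0
  have "{\<omega>. (\<forall>i\<le>m. \<omega> i = p i) \<and> (\<forall>i. m < i \<and> i \<le> m + 0 \<longrightarrow> \<omega> i \<in> A)} = {\<omega>. \<forall>i\<le>m. \<omega> i = p i}"
    by auto
  then show ?case by simp
next
  case (Suc n)
  interpret prob_space "chain_law K z0" by (rule prob_space_chain_law[OF K])
  have nonneg: "0 \<le> K z z'" for z z'
    using K by (simp add: stochastic_kernel_def)
  \<comment> \<open>Prescribing one more state multiplies the cylinder probability by one factor of
    \<open>K\<close>; the update of \<open>p\<close> at \<open>Suc m\<close> leaves the earlier
    factors alone.\<close>
  have cyl: "emeasure (chain_law K z0) {\<omega>. \<forall>i\<le>Suc m. \<omega> i = (p(Suc m := z')) i}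
      = emeasure (chain_law K z0) {\<omega>. \<forall>i\<le>m. \<omega> i = p i} * ennreal (K (p m) z')" for z'
  proof -
    have "(\<Prod>i<m. K ((p(Suc m := z')) i) ((p(Suc m := z')) (Suc i))) = (\<Prod>i<m. K (p i) (p (Suc i)))"
      by (intro prod.cong) auto
    then show ?thesis
      unfolding emeasure_eq_measure chain_law_cylinder[OF K]
      by (simp add: ennreal_mult[symmetric] prod_nonneg nonneg)
  qed
  define X where "X z' = {\<omega>. (\<forall>i\<le>Suc m. \<omega> i = (p(Suc m := z')) i) \<and>
      (\<forall>i. Suc m < i \<and> i \<le> Suc m + n \<longrightarrow> \<omega> i \<in> A)}" for z'
  have "{\<omega>. (\<forall>i\<le>m. \<omega> i = p i) \<and> (\<forall>i. m < i \<and> i \<le> m + Suc n \<longrightarrow> \<omega> i \<in> A)} = (\<Union>z'\<in>A. X z')"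
    (is "?L = ?R")
  proof
    show "?L \<subseteq> ?R"
    proof
      fix \<omega> assume w: "\<omega> \<in> ?L"
      then have "\<omega> \<in> X (\<omega> (Suc m))" "\<omega> (Suc m) \<in> A"
        by (auto simp: X_def le_Suc_eq)
      then show "\<omega> \<in> ?R" by blast
    qed
    show "?R \<subseteq> ?L"
    proof
      fix \<omega> assume "\<omega> \<in> ?R"
      then obtain z' where z': "z' \<in> A" "\<omega> \<in> X z'" by blast
      then have "\<omega> (Suc m) = z'" "\<forall>i\<le>m. \<omega> i = p i"
        by (auto simp: X_def split: if_splits)
      moreover have "\<omega> i \<in> A" if "m < i" "i \<le> m + Suc n" for i
        using that z' \<open>\<omega> (Suc m) = z'\<close> by (cases "i = Suc m") (auto simp: X_def)
      ultimately show "\<omega> \<in> ?L" by blast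
    qed
  qed
  also have "emeasure (chain_law K z0) (\<Union>z'\<in>A. X z')
      = (\<integral>\<^sup>+z'. emeasure (chain_law K z0) (X z') \<partial>count_space A)"
  proof (rule emeasure_UN_countable)
    show "countable A" by (rule countable_subset[OF subset_UNIV cnt])
    show "X z' \<in> sets (chain_law K z0)" for z'
    proof -
      have "X z' = {\<omega>. \<forall>i. i \<le> Suc m + n \<longrightarrow>
          (i \<le> Suc m \<longrightarrow> \<omega> i = (p(Suc m := z')) i) \<and> (Suc m < i \<longrightarrow> \<omega> i \<in> A)}"
        by (auto simp: X_def)
      then show ?thesis using sets_coordinates[OF K, where Q = "\<lambda>i. i \<le> Suc m + n"
          and P = "\<lambda>i x. (i \<le> Suc m \<longrightarrow> x = (p(Suc m := z')) i) \<and> (Suc m < i \<longrightarrow> x \<in> A)"]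
        by (simp only:)
    qed
    show "disjoint_family_on X A"
      unfolding disjoint_family_on_def
    proof (intro ballI impI)
      show "X z1 \<inter> X z2 = {}" if "z1 \<noteq> z2" for z1 z2
      proof -
        have "\<omega> (Suc m) = z'" if "\<omega> \<in> X z'" for \<omega> z'
        proof -
          have "\<omega> (Suc m) = (p(Suc m := z')) (Suc m)"
            using that unfolding X_def by blast
          then show ?thesis by simp
        qed
        with that show ?thesis by blast
      qed
    qed
  qed
  also have "\<dots> = (\<integral>\<^sup>+z'. emeasure (chain_law K z0) {\<omega>. \<forall>i\<le>m. \<omega> i = p i} *
      (ennreal (K (p m) z') * stay K A n z') \<partial>count_space A)"
    unfolding X_def Suc.IH cyl by (simp add: mult.assoc)
  also have "\<dots> = emeasure (chain_law K z0) {\<omega>. \<forall>i\<le>m. \<omega> i = p i} * stay K A (Suc n) (p m)"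
    by (simp add: nn_integral_cmult)
  finally show ?case .
qed

text \<open>This is the cylinder formula at \<open>m = 0\<close>: the chain starts at
  \<open>z\<close> almost surely, so the cylinder has mass 1 and drops out of the event.\<close>

lemma stay_eq_stay_prob:
  fixes K :: "'a \<Rightarrow> 'a \<Rightarrow> real"
  assumes K: "stochastic_kernel K" and cnt: "countable (UNIV :: 'a set)"
  shows "stay K A n z = ennreal (stay_prob K A n z)"
proof -
  interpret prob_space "chain_law K z" by (rule prob_space_chain_law[OF K])
  have one: "emeasure (chain_law K z) {\<omega>. \<forall>i\<le>0. \<omega> i = z} = 1"
    using chain_law_cylinder[OF K, of z 0 "\<lambda>_. z"] by (simp add: emeasure_eq_measure)
  have m: "{\<omega>. \<forall>i. 1 \<le> i \<and> i \<le> n \<longrightarrow> \<omega> i \<in> A} \<in> sets (chain_law K z)"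
    by (rule sets_coordinates[OF K])
  have start: "AE \<omega> in chain_law K z. \<omega> 0 = z"
    using one by (intro AE_I_eq_1) (simp_all add: space_chain_law[OF K] sets_coordinate[OF K, of "\<lambda>x. x = z" 0])
  have "stay K A n z
      = emeasure (chain_law K z) {\<omega>. (\<forall>i\<le>0. \<omega> i = z) \<and> (\<forall>i. 0 < i \<and> i \<le> 0 + n \<longrightarrow> \<omega> i \<in> A)}"
    using emeasure_cylinder_stay[OF K cnt, of z 0 "\<lambda>_. z" n A] one by simp
  also have "\<dots> = emeasure (chain_law K z) {\<omega>. \<forall>i. 1 \<le> i \<and> i \<le> n \<longrightarrow> \<omega> i \<in> A}"
  proof (rule emeasure_eq_AE)
    show "{\<omega>. (\<forall>i\<le>0. \<omega> i = z) \<and> (\<forall>i. 0 < i \<and> i \<le> 0 + n \<longrightarrow> \<omega> i \<in> A)} \<in> sets (chain_law K z)"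
      using sets.Int[OF sets_coordinate[OF K, of "\<lambda>x. x = z" 0 z] m]
      by (simp add: Int_def Suc_le_eq)
  qed (use start m in \<open>auto simp: Suc_le_eq\<close>)
  finally show ?thesis by (simp add: stay_prob_def emeasure_eq_measure)
qed

section \<open>First-step equations and comparison\<close>

lemma stay_prob_0:
  assumes "stochastic_kernel K"
  shows "stay_prob K A 0 z = 1"
proof -
  interpret prob_space "chain_law K z" by (rule prob_space_chain_law[OF assms])
  show ?thesis using prob_space by (simp add: stay_prob_def space_chain_law[OF assms, symmetric, of z])
qed

text \<open>First-step decomposition for the chain killed outside \<open>A\<close>; since
  \<open>F\<close> carries the whole row at \<open>z\<close>, the integral is a finite real
  sum.\<close>

lemma stay_prob_Suc:
  fixes K :: "'a \<Rightarrow> 'a \<Rightarrow> real"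
  assumes K: "stochastic_kernel K" and cnt: "countable (UNIV :: 'a set)"
    and F: "finite F" "\<forall>z'\<in>- F. K z z' = 0"
  shows "stay_prob K A (Suc n) z = (\<Sum>z'\<in>F. K z z' * (if z' \<in> A then stay_prob K A n z' else 0))"
proof -
  have nonneg: "0 \<le> K z z'" for z'
    using K by (simp add: stochastic_kernel_def)
  have s0: "0 \<le> stay_prob K A n z'" for n z'
    by (simp add: stay_prob_def)
  have "ennreal (stay_prob K A (Suc n) z)
      = (\<integral>\<^sup>+z'. ennreal (K z z') * ennreal (stay_prob K A n z') \<partial>count_space A)"
    unfolding stay_eq_stay_prob[OF K cnt, symmetric] by simp
  also have "\<dots> = (\<Sum>z'\<in>F \<inter> A. ennreal (K z z') * ennreal (stay_prob K A n z'))"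
    using F by (intro nn_integral_count_space') auto
  also have "\<dots> = ennreal (\<Sum>z'\<in>F \<inter> A. K z z' * stay_prob K A n z')"
    using nonneg s0 by (simp add: ennreal_mult[symmetric] sum_ennreal)
  finally have "stay_prob K A (Suc n) z = (\<Sum>z'\<in>F \<inter> A. K z z' * stay_prob K A n z')"
    using nonneg s0 by (simp add: sum_nonneg)
  also have "\<dots> = (\<Sum>z'\<in>F. if z' \<in> A then K z z' * stay_prob K A n z' else 0)"
    using F(1) by (simp add: sum.inter_restrict)
  also have "\<dots> = (\<Sum>z'\<in>F. K z z' * (if z' \<in> A then stay_prob K A n z' else 0))"
    by (intro sum.cong) auto
  finally show ?thesis .
qed

text \<open>Continuity from above: the events of staying up to time \<open>n\<close> decrease to the
  escape event.\<close>

lemma stay_prob_tendsto: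
  assumes "stochastic_kernel K"
  shows "(\<lambda>n. stay_prob K A n z) \<longlonglongrightarrow> escape_prob K A z"
proof -
  interpret prob_space "chain_law K z" by (rule prob_space_chain_law[OF assms])
  let ?X = "\<lambda>n. {\<omega> :: nat \<Rightarrow> _. \<forall>i. 1 \<le> i \<and> i \<le> n \<longrightarrow> \<omega> i \<in> A}"
  have "(\<lambda>n. measure (chain_law K z) (?X n)) \<longlonglongrightarrow> measure (chain_law K z) (\<Inter>n. ?X n)"
  proof (rule finite_Lim_measure_decseq)
    show "range ?X \<subseteq> sets (chain_law K z)" by (rule image_subsetI) (rule sets_coordinates[OF assms])
    show "decseq ?X" by (auto simp: decseq_def)
  qed
  moreover have "(\<Inter>n. ?X n) = {\<omega>. \<forall>n\<ge>1. \<omega> n \<in> A}"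
    by auto
  ultimately show ?thesis by (simp add: stay_prob_def escape_prob_def)
qed

lemma escape_prob_step:
  fixes K :: "'a \<Rightarrow> 'a \<Rightarrow> real"
  assumes K: "stochastic_kernel K" and cnt: "countable (UNIV :: 'a set)"
    and F: "finite F" "\<forall>z'\<in>- F. K z z' = 0"
  shows "escape_prob K A z = (\<Sum>z'\<in>F. K z z' * (if z' \<in> A then escape_prob K A z' else 0))"
proof (rule LIMSEQ_unique)
  show "(\<lambda>n. stay_prob K A (Suc n) z) \<longlonglongrightarrow> escape_prob K A z"
    using LIMSEQ_Suc[OF stay_prob_tendsto[OF K]] .
  have "(\<lambda>n. if z' \<in> A then stay_prob K A n z' else 0) \<longlonglongrightarrow> (if z' \<in> A then escape_prob K A z' else 0)" for z'
    using stay_prob_tendsto[OF K] by simp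
  then have "(\<lambda>n. \<Sum>z'\<in>F. K z z' * (if z' \<in> A then stay_prob K A n z' else 0))
      \<longlonglongrightarrow> (\<Sum>z'\<in>F. K z z' * (if z' \<in> A then escape_prob K A z' else 0))"
    by (intro tendsto_sum tendsto_mult tendsto_const)
  then show "(\<lambda>n. stay_prob K A (Suc n) z)
      \<longlonglongrightarrow> (\<Sum>z'\<in>F. K z z' * (if z' \<in> A then escape_prob K A z' else 0))"
    by (subst stay_prob_Suc[OF K cnt F])
qed

lemma escape_prob_le_1:
  assumes "stochastic_kernel K"
  shows "escape_prob K A z \<le> 1"
proof -
  interpret prob_space "chain_law K z" by (rule prob_space_chain_law[OF assms])
  show ?thesis by (simp add: escape_prob_def)
qed

text \<open>The killed kernel preserves order and \<open>stay_prob\<close> starts from 1, so a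
  subharmonic \<open>q\<close> bounded by 1 lies below every \<open>stay_prob K A n\<close> on
  \<open>A\<close>, hence below the limit.\<close>

lemma escape_prob_ge:
  fixes K :: "'a \<Rightarrow> 'a \<Rightarrow> real"
  assumes K: "stochastic_kernel K" and cnt: "countable (UNIV :: 'a set)"
    and F: "\<And>z. finite (F z)" "\<And>z. \<forall>z'\<in>- F z. K z z' = 0"
    and q: "\<And>z. q z \<le> 1" "\<And>z. z \<in> A \<Longrightarrow> q z \<le> (\<Sum>z'\<in>F z. K z z' * (if z' \<in> A then q z' else 0))"
    and z: "z \<in> A"
  shows "q z \<le> escape_prob K A z"
proof (rule LIMSEQ_le_const[OF stay_prob_tendsto[OF K]])
  have nonneg: "0 \<le> K z z'" for z z'
    using K by (simp add: stochastic_kernel_def)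
  have "q z \<le> stay_prob K A n z" for n
    using z
  proof (induction n arbitrary: z)
    case 0
    then show ?case using q by (simp add: stay_prob_0[OF K])
  next
    case (Suc n)
    have "q z \<le> (\<Sum>z'\<in>F z. K z z' * (if z' \<in> A then q z' else 0))"
      using q Suc.prems by blast
    also have "\<dots> \<le> (\<Sum>z'\<in>F z. K z z' * (if z' \<in> A then stay_prob K A n z' else 0))"
      using Suc.IH nonneg by (intro sum_mono mult_left_mono) auto
    finally show ?case using stay_prob_Suc[OF K cnt F(1)[of z] F(2)[of z]] by simp
  qed
  then show "\<exists>N. \<forall>n\<ge>N. q z \<le> stay_prob K A n z" by blast
qed

section \<open>Maximum principle for rows of finite support\<close>

lemma stochastic_kernel_sum:
  assumes "stochastic_kernel K" "finite F" "\<forall>z'\<in>- F. K z z' = 0"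
  shows "(\<Sum>z'\<in>F. K z z') = 1"
proof -
  have "(K z has_sum (\<Sum>z'\<in>F. K z z')) UNIV"
    using assms(2,3) by (intro has_sum_finite_neutralI) auto
  moreover have "(K z has_sum 1) UNIV" using assms(1) by (simp add: stochastic_kernel_def)
  ultimately show ?thesis using has_sum_unique by blast
qed

text \<open>The weights sum to 1, so the nonnegative terms \<open>K z z' * (f z - f z')\<close> have
  a sum that is at most 0, and each of them vanishes.\<close>

lemma maximum_principle:
  fixes f :: "'a \<Rightarrow> real"
  assumes K: "stochastic_kernel K" and F: "finite F" "\<forall>z'\<in>- F. K z z' = 0"
    and sub: "f z \<le> (\<Sum>z'\<in>F. K z z' * f z')" and max: "\<And>z'. f z' \<le> f z"
    and y: "K z y > 0"
  shows "f y = f z"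
proof -
  have nonneg: "0 \<le> K z z'" for z'
    using K by (simp add: stochastic_kernel_def)
  have "(\<Sum>z'\<in>F. K z z' * (f z - f z')) = f z * (\<Sum>z'\<in>F. K z z') - (\<Sum>z'\<in>F. K z z' * f z')"
    by (simp add: algebra_simps sum_subtractf sum_distrib_left)
  also have "\<dots> \<le> 0" using stochastic_kernel_sum[OF K F] sub by simp
  finally have "(\<Sum>z'\<in>F. K z z' * (f z - f z')) = 0"
    using nonneg max by (intro antisym sum_nonneg) auto
  then have "\<forall>z'\<in>F. K z z' * (f z - f z') = 0"
    using nonneg max by (subst (asm) sum_nonneg_eq_0_iff[OF F(1)]) auto
  moreover have "y \<in> F" using y F(2) by force
  ultimately show ?thesis using y by auto
qed

section \<open>Escape probabilities of the twisted free process\<close>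

lemma UNIV_server: "(UNIV :: server set) = {Up, Down}"
  by (auto intro: server.exhaust)

lemma countable_UNIV_states: "countable (UNIV :: (int \<times> server) set)"
proof -
  have "countable ((UNIV :: int set) \<times> (UNIV :: server set))"
    by (intro countable_SIGMA) (auto simp: UNIV_server)
  then show ?thesis by simp
qed

fun neighbours :: "int \<times> server \<Rightarrow> (int \<times> server) set" where
  "neighbours (x, s) = {(x - 1, Up), (x - 1, Down), (x, Up), (x, Down), (x + 1, Up), (x + 1, Down)}"

lemma finite_neighbours: "finite (neighbours z)"
  by (cases z) simp

lemma free_kernel_outside: "\<forall>z'\<in>- neighbours z. free_kernel C lam \<mu> \<alpha> \<beta> z z' = 0"
proof
  fix z' assume z': "z' \<in> - neighbours z"
  obtain x s y u where "z = (x, s)" "z' = (y, u)" by (cases z; cases z')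
  with z' show "free_kernel C lam \<mu> \<alpha> \<beta> z z' = 0" by (cases u) auto
qed

lemma sum_free_kernel:
  "C > 0 \<Longrightarrow> (\<Sum>z'\<in>neighbours z. free_kernel C lam \<mu> \<alpha> \<beta> z z') = 1"
  by (cases z rule: neighbours.cases; rename_tac x s; case_tac s) (auto simp: field_simps)

section \<open>Algebra of the parameters\<close>

locale stable_server =
  fixes lam \<mu> \<alpha> \<beta> C :: real
  assumes pos: "lam > 0" "\<mu> > 0" "\<alpha> > 0" "\<beta> > 0"
    and stable: "lam < \<beta> / (\<alpha> + \<beta>) * \<mu>"
    and C: "C \<ge> lam + \<mu> + \<alpha> + \<beta>"
begin

definition g :: real where "g = gamma1 lam \<mu> \<alpha> \<beta>"

definition r :: real where "r = 2 * \<beta> / (lam + \<beta> - \<mu> - \<alpha> + sqrt (s1 lam \<mu> \<alpha> \<beta>))"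

text \<open>The harmonic equations say that \<open>h\<close> is harmonic for the free process in
  either server state. \<open>half_w\<close> and \<open>half_d\<close> rewrite the square-root
  expressions through \<open>g\<close> and \<open>r\<close>, so that the root does not appear in
  later algebra. The proofs rationalise with conjugates such as
  \<open>(a - t) * (a + t)\<close>.\<close>

lemma parameters:
  "0 < g" "g < 1" "1 < r"
  and harmonic_Up: "lam / g + \<mu> * g + \<alpha> * r = lam + \<mu> + \<alpha>"
  and harmonic_Down: "lam / g + \<beta> / r = lam + \<beta>"
  and second_eigenvalue: "lam\<^sup>2 / (\<mu> * (lam + \<beta>) * g) < g"
  and half_w: "(lam + \<beta> - \<mu> - \<alpha> + sqrt (s1 lam \<mu> \<alpha> \<beta>)) / 2 = \<beta> / r"
  and half_d: "(lam + \<beta> + \<mu> + \<alpha> - sqrt (s1 lam \<mu> \<alpha> \<beta>)) / 2 = lam / g"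
proof -
  define t where "t = sqrt (s1 lam \<mu> \<alpha> \<beta>)"
  define a where "a = lam + \<beta> + \<mu> + \<alpha>"
  have s: "s1 lam \<mu> \<alpha> \<beta> > 0" using pos by (simp add: s1_def add_nonneg_pos)
  then have t2: "t * t = (\<mu> - lam - \<beta> - \<alpha>)\<^sup>2 + 4 * \<alpha> * \<mu>"
    by (simp add: t_def s1_def)
  have t0: "t > 0" using s by (simp add: t_def)
  have e1: "(a - t) * (a + t) = 4 * \<mu> * (lam + \<beta>)"
    using t2 by (simp add: a_def power2_eq_square algebra_simps)
  have stab: "lam * (\<alpha> + \<beta>) < \<beta> * \<mu>"
    using stable pos by (simp add: field_simps)
  \<comment> \<open>This amounts to \<open>g < 1\<close>. Stability enters through \<open>(a - 2 *
    lam)\<^sup>2 - t\<^sup>2 = 4 * (\<beta> * \<mu> - lam * (\<alpha> + \<beta>))\<close>; the bound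
    \<open>lam < \<mu>\<close> makes \<open>a - 2 * lam\<close> nonnegative, so squares can be
    compared.\<close>
  have d: "2 * lam < a - t"
  proof -
    have "0 < lam * \<alpha>" using pos by simp
    then have "lam * \<beta> < \<beta> * \<mu>" using stab by (simp add: distrib_left)
    then have "lam < \<mu>" using pos by (simp add: mult.commute[of lam])
    moreover have "t\<^sup>2 < (a - 2 * lam)\<^sup>2"
      using t2 stab by (simp add: a_def power2_eq_square algebra_simps)
    ultimately have "t < a - 2 * lam"
      using pos by (intro power_less_imp_less_base[of t 2]) (auto simp: a_def)
    then show ?thesis by simp
  qed
  have gd: "g = 2 * lam / (a - t)" by (simp add: g_def gamma1_def a_def t_def)
  show g0: "0 < g" and g1: "g < 1" using d pos by (auto simp: gd)
  have lg: "lam / g = (a - t) / 2" using d pos by (simp add: gd)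
  then show "(lam + \<beta> + \<mu> + \<alpha> - sqrt (s1 lam \<mu> \<alpha> \<beta>)) / 2 = lam / g"
    by (simp add: a_def t_def)
  define w where "w = lam + \<beta> - \<mu> - \<alpha> + t"
  have "w * (t - (lam + \<beta> - \<mu> - \<alpha>)) = 4 * \<alpha> * (lam + \<beta>)"
    using t2 by (simp add: w_def power2_eq_square algebra_simps)
  moreover have "4 * \<alpha> * (lam + \<beta>) > 0" using pos by simp
  ultimately have w: "w > 0"
    using t0 unfolding w_def by (smt (verit) mult_nonpos_nonneg)
  have rw: "r = 2 * \<beta> / w" by (simp add: r_def w_def t_def)
  have r0: "r > 0" using pos w by (simp add: rw)
  have br: "\<beta> / r = w / 2" using w pos by (simp add: rw)
  then show "(lam + \<beta> - \<mu> - \<alpha> + sqrt (s1 lam \<mu> \<alpha> \<beta>)) / 2 = \<beta> / r"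
    by (simp add: w_def t_def)
  show D: "lam / g + \<beta> / r = lam + \<beta>"
    unfolding lg br by (simp add: a_def w_def field_simps)
  have "lam / g > lam" using g0 g1 pos by (simp add: field_simps)
  then have "\<beta> / r < \<beta>" using D by simp
  then show "1 < r" using pos r0 by (simp add: field_simps)
  have mg: "\<mu> * g = lam * (a + t) / (2 * (lam + \<beta>))"
  proof -
    have "lam * ((a - t) * (a + t)) = lam * (4 * \<mu> * (lam + \<beta>))" by (simp add: e1)
    then show ?thesis using d pos by (simp add: gd divide_simps) (simp add: algebra_simps)
  qed
  have ar: "\<alpha> * r = \<beta> * (t - (lam + \<beta> - \<mu> - \<alpha>)) / (2 * (lam + \<beta>))"
  proof -
    have "\<beta> * (w * (t - (lam + \<beta> - \<mu> - \<alpha>))) = \<beta> * (4 * \<alpha> * (lam + \<beta>))"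
      using t2 by (simp add: w_def power2_eq_square algebra_simps)
    then show ?thesis using w pos by (simp add: rw divide_simps) (simp add: algebra_simps)
  qed
  have "\<mu> * g + \<alpha> * r = (lam * (a + t) + \<beta> * (t - (lam + \<beta> - \<mu> - \<alpha>))) / (2 * (lam + \<beta>))"
    by (simp add: mg ar add_divide_distrib)
  also have "lam * (a + t) + \<beta> * (t - (lam + \<beta> - \<mu> - \<alpha>)) = (lam - \<beta> + \<mu> + \<alpha> + t) * (lam + \<beta>)"
    by (simp add: a_def algebra_simps)
  also have "\<dots> / (2 * (lam + \<beta>)) = (lam - \<beta> + \<mu> + \<alpha> + t) / 2"
    using pos by (intro nonzero_mult_divide_mult_cancel_right) simp
  finally show "lam / g + \<mu> * g + \<alpha> * r = lam + \<mu> + \<alpha>"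
    by (simp add: lg a_def field_simps)
  \<comment> \<open>Both eigenvalues are compared through \<open>2 * lam = (a - t) * g\<close> and
    \<open>mg\<close>; the gap is \<open>a - t < a + t\<close>.\<close>
  have "lam * lam < \<mu> * (lam + \<beta>) * g * g"
  proof -
    have mg': "\<mu> * g * (2 * (lam + \<beta>)) = lam * (a + t)"
      using pos by (intro nonzero_eq_divide_eq[THEN iffD1, OF _ mg]) simp
    have "2 * lam = (a - t) * g" using d pos by (simp add: gd)
    also have "\<dots> < (a + t) * g" using t0 g0 by simp
    finally have "lam * (2 * lam) < lam * ((a + t) * g)" using pos by simp
    also have "\<dots> = \<mu> * g * (2 * (lam + \<beta>)) * g" unfolding mg' by simp
    also have "\<dots> = 2 * (\<mu> * (lam + \<beta>) * g * g)" by (simp add: algebra_simps)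
    finally show ?thesis by simp
  qed
  then show "lam\<^sup>2 / (\<mu> * (lam + \<beta>) * g) < g"
    using pos g0 by (simp add: pos_divide_less_eq power2_eq_square ac_simps)
qed

section \<open>The twist by \<open>h\<close> and the hitting probability of level 0\<close>

abbreviation h :: "int \<times> server \<Rightarrow> real" where "h \<equiv> h1 lam \<mu> \<alpha> \<beta>"

abbreviation K :: "int \<times> server \<Rightarrow> int \<times> server \<Rightarrow> real" where
  "K \<equiv> twisted_kernel C lam \<mu> \<alpha> \<beta>"

abbreviation A :: "(int \<times> server) set" where "A \<equiv> {z. fst z > 0}"

lemma stochastic_K: "stochastic_kernel K"
  using stochastic_kernel_twisted[OF pos C] .

lemma C_pos: "C > 0" using pos C by linarith

lemma h_simps: "h (x, Up) = g powi (- x)" "h (x, Down) = g powi (- x) * r"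
  by (simp_all add: g_def r_def)

lemma h_pos: "h z > 0"
  using parameters(1,3) by (cases z; cases "snd z") (auto simp: h_simps simp del: h1.simps)

lemma K_outside: "\<forall>z'\<in>- neighbours z. K z z' = 0"
  using free_kernel_outside by (simp add: twisted_kernel_def)

text \<open>The twist cancels: \<open>K z z' / h z'\<close> is the free kernel divided by
  \<open>h z\<close>, so both parts of the sum reduce to row sums equal to 1.\<close>

lemma inverse_h_harmonic: "(\<Sum>z'\<in>neighbours z. K z z' * (1 - 1 / h z')) = 1 - 1 / h z"
proof -
  have "K z z' * (1 - 1 / h z') = K z z' - free_kernel C lam \<mu> \<alpha> \<beta> z z' / h z" for z'
    using h_pos[of z'] by (simp add: twisted_kernel_def right_diff_distrib del: h1.simps)
  then have "(\<Sum>z'\<in>neighbours z. K z z' * (1 - 1 / h z'))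
      = (\<Sum>z'\<in>neighbours z. K z z') - (\<Sum>z'\<in>neighbours z. free_kernel C lam \<mu> \<alpha> \<beta> z z') / h z"
    by (simp add: sum_subtractf sum_divide_distrib)
  then show ?thesis
    using stochastic_kernel_sum[OF stochastic_K finite_neighbours K_outside] sum_free_kernel[OF C_pos]
    by simp
qed

text \<open>The down-steps from \<open>A\<close> lead to \<open>(0, Up)\<close>, where \<open>1 - 1 / h\<close> vanishes.\<close>

lemma inverse_h_harmonic_killed:
  assumes "z \<in> A"
  shows "(\<Sum>z'\<in>neighbours z. K z z' * (if z' \<in> A then 1 - 1 / h z' else 0)) = 1 - 1 / h z"
proof -
  have "K z z' * (if z' \<in> A then 1 - 1 / h z' else 0) = K z z' * (1 - 1 / h z')" for z'
  proof (cases "z' \<in> A")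
    case False
    obtain x s y u where z: "z = (x, s)" "z' = (y, u)" by (cases z; cases z')
    have "K z z' = 0 \<or> z' = (0, Up)"
      using assms False by (cases u) (auto simp: z twisted_kernel_def)
    then show ?thesis using False by auto
  qed auto
  then show ?thesis using inverse_h_harmonic by (simp only:)
qed

text \<open>\<open>escape_prob_ge\<close> gives the lower bound. If it were strict at
  \<open>z\<close>, the excess \<open>f\<close> would be positive there, decay with the level and so
  attain its maximum; the maximum principle along up-steps would carry that maximum to arbitrarily
  high levels, where \<open>f\<close> is too small.\<close>

lemma escape_prob_K:
  assumes "z \<in> A"
  shows "escape_prob K A z = 1 - 1 / h z"
proof (rule ccontr)
  define f where "f z = (if z \<in> A then escape_prob K A z - (1 - 1 / h z) else 0)" for z
  have step: "f z = (\<Sum>z'\<in>neighbours z. K z z' * f z')" if "z \<in> A" for z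
  proof -
    have "f z = (\<Sum>z'\<in>neighbours z. K z z' * (if z' \<in> A then escape_prob K A z' else 0))
       - (\<Sum>z'\<in>neighbours z. K z z' * (if z' \<in> A then 1 - 1 / h z' else 0))"
      using escape_prob_step[OF stochastic_K countable_UNIV_states finite_neighbours K_outside, where z = z and A = A]
        inverse_h_harmonic_killed[OF that] that
      by (simp add: f_def)
    also have "\<dots> = (\<Sum>z'\<in>neighbours z. K z z' * f z')"
      unfolding sum_subtractf[symmetric] by (intro sum.cong) (auto simp: f_def algebra_simps)
    finally show ?thesis .
  qed
  assume "escape_prob K A z \<noteq> 1 - 1 / h z"
  moreover have "1 - 1 / h z \<le> escape_prob K A z"
    using inverse_h_harmonic_killed less_imp_le[OF h_pos] assms
    by (intro escape_prob_ge[OF stochastic_K countable_UNIV_states finite_neighbours K_outside]) auto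
  ultimately have fz: "f z > 0" using assms by (simp add: f_def)
  \<comment> \<open>An escape probability is at most 1, so \<open>f\<close> is at most
    \<open>1 / h\<close>, and \<open>r > 1\<close> covers the state \<open>Down\<close>.\<close>
  have up: "f (x, s) \<le> g ^ nat x" if "x > 0" for x s
  proof -
    have "f (x, s) \<le> 1 / h (x, s)"
      using that escape_prob_le_1[OF stochastic_K, where A = A and z = "(x, s)"] by (simp add: f_def)
    also have "\<dots> \<le> g ^ nat x"
      using that parameters(1,3)
      by (cases s) (auto simp: h_simps power_int_minus power_int_def field_simps simp del: h1.simps)
    finally show ?thesis .
  qed
  have "(\<lambda>n. g ^ n) \<longlonglongrightarrow> 0" using parameters by (intro LIMSEQ_power_zero) auto
  then have "\<forall>\<^sub>F n in sequentially. g ^ n < f z" using fz by (rule order_tendstoD)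
  then obtain N where N: "\<And>n. n \<ge> N \<Longrightarrow> g ^ n < f z" by (auto simp: eventually_sequentially)
  have small: "f (x, s) < f z" if "x > int N" for x s
    using up[of x s] N[of "nat x"] that by force
  \<comment> \<open>Above level \<open>N\<close> the function \<open>f\<close> is below
    \<open>f z\<close>, and outside \<open>A\<close> it is 0; so its maximum over this finite box is
    global.\<close>
  define B where "B = {0..int N} \<times> (UNIV :: server set)"
  have B: "finite B" "f ` B \<noteq> {}" by (auto simp: B_def UNIV_server)
  have zB: "z \<in> B" using assms small[of "fst z" "snd z"] by (cases z) (force simp: B_def)
  obtain y where y: "y \<in> B" "f y = Max (f ` B)"
    using Max_in[of "f ` B"] B by fastforce
  have yz: "f z \<le> f y" using y zB B by simp
  have max: "f z' \<le> f y" for z'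
  proof (cases "z' \<in> B")
    case True
    then show ?thesis using y B by simp
  next
    case False
    show ?thesis
    proof (cases "z' \<in> A")
      case True
      then have "f z' < f z" using False small[of "fst z'" "snd z'"] by (cases z') (force simp: B_def)
      then show ?thesis using yz by simp
    next
      case False
      then show ?thesis using yz fz by (simp add: f_def)
    qed
  qed
  \<comment> \<open>Up-steps have positive probability in either server state. Positivity of the
    level is carried along because \<open>step\<close> holds only in \<open>A\<close>.\<close>
  have y_up: "fst y + int n > 0 \<and> f (fst y + int n, snd y) = f y" for n
  proof (induction n)
    case 0
    have "y \<in> A" using yz fz by (auto simp: f_def split: if_splits)
    then show ?case by simp
  next
    case (Suc n)
    let ?y = "(fst y + int n, snd y)" and ?u = "(fst y + int (Suc n), snd y)"
    have "K ?y ?u > 0"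
      using h_pos C_pos pos(1) by (simp add: twisted_kernel_def del: h1.simps)
    then have "f ?u = f ?y"
      using Suc max step[of ?y]
      by (intro maximum_principle[OF stochastic_K finite_neighbours K_outside]) auto
    then show ?case using Suc by simp
  qed
  have "fst y \<ge> 0" using y(1) by (auto simp: B_def)
  then have "f (fst y + int (Suc N), snd y) < f z" by (intro small) simp
  then show False using y_up[of "Suc N"] yz by simp
qed

section \<open>Closed forms of \<open>H1\<close>, \<open>eta1\<close> and \<open>d1\<close>\<close>

lemma H1_eq:
  "H1 C lam \<mu> \<alpha> \<beta> s = lam / (g * C) * (1 - g / (case s of Up \<Rightarrow> 1 | Down \<Rightarrow> r))"
proof -
  have "H1 C lam \<mu> \<alpha> \<beta> s = escape_prob K A (0, s)"
    by (simp add: H1_def escape_prob_def)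
  \<comment> \<open>From level 0 only the up-step enters \<open>A\<close>; from there
    \<open>escape_prob_K\<close> applies at level 1.\<close>
  also have "\<dots> = K (0, s) (1, s) * (1 - 1 / h (1, s))"
    by (subst escape_prob_step[OF stochastic_K countable_UNIV_states finite_neighbours K_outside], cases s) (simp_all add: escape_prob_K twisted_kernel_def del: h1.simps)
  also have "\<dots> = lam / (g * C) * (1 - g / (case s of Up \<Rightarrow> 1 | Down \<Rightarrow> r))"
    using parameters by (cases s) (simp_all add: twisted_kernel_def h_simps inverse_eq_divide del: h1.simps)
  finally show ?thesis .
qed

text \<open>The weight \<open>h (0, Down) = r\<close> clears the denominator in \<open>H1\<close>,
  which leaves the left eigenvector applied to level 0.\<close>

lemma eta1_eq:
  "eta1 C lam \<mu> \<alpha> \<beta> \<pi> =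
     lam / (g * C) * ((1 - g) * pmf \<pi> (0, Up) + (r - g) * pmf \<pi> (0, Down))"
  using parameters C_pos
  by (simp add: eta1_def H1_eq h_simps field_simps del: h1.simps)

text \<open>The pair \<open>(v, \<alpha>)\<close> is the right eigenvector of the recursion for the
  eigenvalue \<open>g\<close>.\<close>

definition v :: real where "v = \<beta> / r"

text \<open>The pairing of the left eigenvector \<open>(1 - g, r - g)\<close> with the right
  eigenvector \<open>(v, \<alpha>)\<close>.\<close>

definition D0 :: real where "D0 = (1 - g) * v + (r - g) * \<alpha>"

lemma v_pos: "0 < v" "v < lam + \<beta>"
  using parameters(1,3) pos harmonic_Down by (simp_all add: v_def) (smt (verit) divide_pos_pos)

lemma D0_pos: "D0 > 0"
  using parameters pos v_pos by (simp add: D0_def add_pos_pos)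

text \<open>The first two identities make \<open>(1 - g, r - g)\<close> a left eigenvector for
  \<open>g\<close>; the last two make \<open>(v, \<alpha>)\<close> a right one.\<close>

lemma harmonic_identities:
  "lam * (r - g) = (lam + \<beta>) * g * (r - 1)"
  "\<alpha> * g * (r - 1) = (1 - g) * (\<mu> * g - lam)"
  "lam = (lam + \<beta> - v) * g"
  "lam * (\<alpha> + v) = \<mu> * g * v"
proof -
  have "lam * r + \<beta> * g = (lam + \<beta>) * (g * r)"
    using harmonic_Down parameters(1,3) by (simp add: field_simps)
  then show 1: "lam * (r - g) = (lam + \<beta>) * g * (r - 1)"
    by (simp add: algebra_simps)
  have "lam + \<mu> * g * g + \<alpha> * r * g = (lam + \<mu> + \<alpha>) * g"
    using harmonic_Up parameters(1) by (simp add: field_simps)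
  then show 2: "\<alpha> * g * (r - 1) = (1 - g) * (\<mu> * g - lam)"
    by (simp add: algebra_simps)
  show 3: "lam = (lam + \<beta> - v) * g"
    using harmonic_Down parameters(1) by (simp add: v_def field_simps)
  have vr: "v * r = \<beta>" using parameters(3) by (simp add: v_def)
  \<comment> \<open>The fourth identity is proved after multiplication by \<open>1 - g\<close>,
    where the second one applies; \<open>g < 1\<close> allows cancelling.\<close>
  have "g * v * (r - 1) = lam * (1 - g)"
    using 3 vr by (simp add: algebra_simps)
  then have "(1 - g) * (lam * \<alpha>) = (\<alpha> * g * (r - 1)) * v"
    by (simp add: mult.commute mult.left_commute)
  also have "\<dots> = (1 - g) * ((\<mu> * g - lam) * v)" by (subst 2) (simp only: mult.assoc)
  finally have "(1 - g) * (lam * (\<alpha> + v)) = (1 - g) * (\<mu> * g * v)"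
    by (simp add: algebra_simps)
  then show "lam * (\<alpha> + v) = \<mu> * g * v"
    using parameters(2) by simp
qed

text \<open>By the fourth identity \<open>d1\<close> equals \<open>lam * D0 / (g * C * G)\<close>.
  The factor \<open>lam / (g * C)\<close> is shared with \<open>eta1\<close>, so the quotient is
  free of \<open>C\<close>.\<close>

lemma eta1_div_d1:
  "eta1 C lam \<mu> \<alpha> \<beta> \<pi> / d1 C lam \<mu> \<alpha> \<beta>
     = ((1 - g) * pmf \<pi> (0, Up) + (r - g) * pmf \<pi> (0, Down)) * G1 lam \<mu> \<alpha> \<beta> / D0"
  and G1_eq: "G1 lam \<mu> \<alpha> \<beta> = v + \<alpha> * r"
proof -
  define w where "w = lam + \<beta> - \<mu> - \<alpha> + sqrt (s1 lam \<mu> \<alpha> \<beta>)"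
  define d where "d = lam + \<beta> + \<mu> + \<alpha> - sqrt (s1 lam \<mu> \<alpha> \<beta>)"
  have w: "w = 2 * v" using half_w by (simp add: w_def v_def)
  have d: "d = 2 * (lam / g)" using half_d by (simp add: d_def)
  have "2 * \<alpha> * \<beta> / w = \<alpha> * r" by (simp add: r_def w_def)
  then show G: "G1 lam \<mu> \<alpha> \<beta> = v + \<alpha> * r"
    using w by (simp add: G1_def w_def)
  define G where "G = v + \<alpha> * r"
  have G_pos: "G > 0" using v_pos parameters pos by (simp add: G_def add_pos_pos)
  have "d1 C lam \<mu> \<alpha> \<beta> = 1 / C * (d / 2 - 1 / G * lam * \<mu> * (w / d))"
    by (simp add: d1_def w_def d_def G G_def)
  also have "\<dots> = 1 / C * (lam / g - \<mu> * g * v / G)"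
    using pos parameters(1) by (simp add: w d)
  also have "\<dots> = 1 / C * (lam / g - lam * (\<alpha> + v) / G)"
    by (simp add: harmonic_identities(4))
  also have "\<dots> = lam * (G - g * (\<alpha> + v)) / (g * C * G)"
    using G_pos C_pos parameters(1) by (simp add: field_simps)
  also have "G - g * (\<alpha> + v) = D0" by (simp add: G_def D0_def algebra_simps)
  finally show "eta1 C lam \<mu> \<alpha> \<beta> \<pi> / d1 C lam \<mu> \<alpha> \<beta>
     = ((1 - g) * pmf \<pi> (0, Up) + (r - g) * pmf \<pi> (0, Down)) * G1 lam \<mu> \<alpha> \<beta> / D0"
    using pos parameters(1) C_pos G_pos D0_pos by (simp add: eta1_eq G G_def[symmetric])
qed

end

section \<open>The stationary distribution\<close>

lemma has_sum_finite_support: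
  fixes f :: "'a \<Rightarrow> real"
  assumes "finite F" "\<forall>z\<in>- F. f z = 0"
  shows "(f has_sum (\<Sum>z\<in>F. f z)) UNIV"
  using assms by (intro has_sum_finite_neutralI) auto

text \<open>Finite supports of inflow and outflow turn the infinite sums in the definition into
  finite ones.\<close>

lemma stationary_distribution_balance:
  assumes "stationary_distribution q \<pi>"
    and F: "finite F" "\<forall>z'\<in>- F. q z' z = 0" and F': "finite F'" "\<forall>z'\<in>- F'. q z z' = 0"
  shows "(\<Sum>z'\<in>F. pmf \<pi> z' * q z' z) = pmf \<pi> z * (\<Sum>z'\<in>F'. q z z')"
proof (rule has_sum_unique)
  show "((\<lambda>z'. pmf \<pi> z' * q z' z) has_sum (\<Sum>z'\<in>F. pmf \<pi> z' * q z' z)) UNIV"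
    using F by (intro has_sum_finite_support) auto
  have "(\<Sum>\<^sub>\<infinity>z'. q z z') = (\<Sum>z'\<in>F'. q z z')"
    using F' by (intro infsumI has_sum_finite_support)
  with assms(1) show "((\<lambda>z'. pmf \<pi> z' * q z' z) has_sum (pmf \<pi> z * (\<Sum>z'\<in>F'. q z z'))) UNIV"
    unfolding stationary_distribution_def by metis
qed

locale stationary_server = stable_server +
  fixes \<pi> :: "(nat \<times> server) pmf"
  assumes stationary: "stationary_distribution (rate lam \<mu> \<alpha> \<beta>) \<pi>"
begin

section \<open>Balance equations and the linear recursion\<close>

abbreviation u :: "nat \<Rightarrow> real" where "u k \<equiv> pmf \<pi> (k, Up)"

abbreviation d :: "nat \<Rightarrow> real" where "d k \<equiv> pmf \<pi> (k, Down)"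

lemma all_states: "(\<forall>z. P z) \<longleftrightarrow> (\<forall>k. P (k, Up) \<and> P (k, Down))"
  by (metis server.exhaust surj_pair)

lemma rate_support:
  "\<forall>z'\<in>- {(Suc 0, Up), (0, Down)}. rate lam \<mu> \<alpha> \<beta> z' (0, Up) = 0"
  "\<forall>z'\<in>- {(Suc 0, Up), (0, Down)}. rate lam \<mu> \<alpha> \<beta> (0, Up) z' = 0"
  "\<forall>z'\<in>- {(k, Up), (Suc (Suc k), Up), (Suc k, Down)}. rate lam \<mu> \<alpha> \<beta> z' (Suc k, Up) = 0"
  "\<forall>z'\<in>- {(k, Up), (Suc (Suc k), Up), (Suc k, Down)}. rate lam \<mu> \<alpha> \<beta> (Suc k, Up) z' = 0"
  "\<forall>z'\<in>- {(0, Up)}. rate lam \<mu> \<alpha> \<beta> z' (0, Down) = 0"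
  "\<forall>z'\<in>- {(k, Down), (Suc k, Up)}. rate lam \<mu> \<alpha> \<beta> z' (Suc k, Down) = 0"
  "\<forall>z'\<in>- {(Suc k, Down), (k, Up)}. rate lam \<mu> \<alpha> \<beta> (k, Down) z' = 0"
  by (auto simp: Ball_def all_states)

lemma balance:
  "u 0 * (lam + \<alpha>) = \<mu> * u (Suc 0) + \<beta> * d 0"
  "u (Suc k) * (lam + \<mu> + \<alpha>) = lam * u k + \<mu> * u (Suc (Suc k)) + \<beta> * d (Suc k)"
  "d 0 * (lam + \<beta>) = \<alpha> * u 0"
  "d (Suc k) * (lam + \<beta>) = lam * d k + \<alpha> * u (Suc k)"
proof -
  note balance = stationary_distribution_balance[OF stationary]
  show "u 0 * (lam + \<alpha>) = \<mu> * u (Suc 0) + \<beta> * d 0"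
    using balance[OF _ rate_support(1) _ rate_support(2)] by (simp add: algebra_simps)
  show "u (Suc k) * (lam + \<mu> + \<alpha>) = lam * u k + \<mu> * u (Suc (Suc k)) + \<beta> * d (Suc k)"
    using balance[OF _ rate_support(3)[of k] _ rate_support(4)[of k]] by (simp add: algebra_simps)
  show "d 0 * (lam + \<beta>) = \<alpha> * u 0"
    using balance[OF _ rate_support(5) _ rate_support(7)[of 0]] by (simp add: algebra_simps)
  show "d (Suc k) * (lam + \<beta>) = lam * d k + \<alpha> * u (Suc k)"
    using balance[OF _ rate_support(6)[of k] _ rate_support(7)[of "Suc k"]] by (simp add: algebra_simps)
qed

text \<open>Adding the two balance equations of level \<open>Suc k\<close> cancels the switching
  terms, so the net flow between adjacent levels is the same at every height; at the bottom it is
  0.\<close>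

lemma cut: "\<mu> * u (Suc k) = lam * (u k + d k)"
proof (induction k)
  case 0
  show ?case using balance(1,3) by (simp add: algebra_simps)
next
  case (Suc k)
  show ?case using Suc balance(2,4)[of k] by (simp add: algebra_simps)
qed

text \<open>Otherwise the recursion would propagate 0 to every state, whereas a \<open>pmf\<close>
  has nonempty support.\<close>

lemma u_0_pos: "u 0 > 0"
proof (rule ccontr)
  assume "\<not> u 0 > 0"
  then have "u 0 = 0" by (simp add: order_less_le)
  have "u k = 0 \<and> d k = 0" for k
  proof (induction k)
    case 0
    show ?case using \<open>u 0 = 0\<close> balance(3) pos by simp
  next
    case (Suc k)
    then have "u (Suc k) = 0" using cut[of k] pos by simp
    then show ?case using Suc balance(4)[of k] pos by simp
  qed
  then have "pmf \<pi> z = 0" for z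
    by (cases z; cases "snd z") auto
  then show False
    using set_pmf_not_empty[of \<pi>] by (auto simp: set_pmf_eq)
qed

text \<open>\<open>E\<close> and \<open>F\<close> are the left eigenvectors of the recursion, for the larger and the smaller eigenvalue.\<close>

definition E where "E k = (1 - g) * u k + (r - g) * d k"

definition F where "F k = \<alpha> * u k - v * d k"

lemma E_eq: "E k = g ^ k * E 0"
proof (induction k)
  case (Suc k)
  define b where "b = lam + \<beta>"
  have b: "b > 0" using pos by (simp add: b_def)
  have "\<mu> * b * E (Suc k) = (1 - g) * b * (\<mu> * u (Suc k)) + (r - g) * (\<mu> * (d (Suc k) * b))"
    by (simp add: E_def algebra_simps)
  \<comment> \<open>The cut equation is applied twice: to the direct term and to the
    \<open>u (Suc k)\<close> inside the balance of \<open>d (Suc k)\<close>.\<close>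
  also have "\<dots> = (1 - g) * b * (lam * (u k + d k)) + lam * (r - g) * (\<mu> * d k + \<alpha> * (u k + d k))"
    unfolding balance(4)[of k, folded b_def] distrib_left[of \<mu>] mult.left_commute[of \<mu> \<alpha>] cut
    by (simp add: algebra_simps)
  also have "\<dots> = (1 - g) * b * (lam * (u k + d k))
      + b * (g * (r - 1) * \<mu> * d k + \<alpha> * g * (r - 1) * (u k + d k))"
    unfolding harmonic_identities(1)[folded b_def] by (simp add: algebra_simps)
  also have "\<dots> = \<mu> * b * (g * E k)"
    unfolding harmonic_identities(2) by (simp add: E_def algebra_simps)
  finally have "E (Suc k) = g * E k" using b pos by simp
  then show ?case by (simp add: Suc.IH)
qed simp

text \<open>\<open>F\<close> annihilates \<open>(v, \<alpha>)\<close>, so it belongs to the other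
  eigenvalue, which is the determinant \<open>lam\<^sup>2 / (\<mu> * (lam + \<beta>))\<close> of the
  recursion divided by \<open>g\<close>.\<close>

lemma F_eq: "F k = (lam\<^sup>2 / (\<mu> * (lam + \<beta>) * g)) ^ k * F 0"
proof (induction k)
  case (Suc k)
  define b where "b = lam + \<beta>"
  have b: "b > 0" using pos by (simp add: b_def)
  have bv: "b - v = lam / g"
    using harmonic_identities(3) parameters(1) by (simp add: b_def field_simps)
  have "\<mu> * b * F (Suc k) = \<alpha> * b * (\<mu> * u (Suc k)) - v * (\<mu> * (d (Suc k) * b))"
    by (simp add: F_def algebra_simps)
  also have "\<dots> = \<alpha> * b * (lam * (u k + d k)) - v * lam * (\<mu> * d k + \<alpha> * (u k + d k))"
    unfolding balance(4)[of k, folded b_def] distrib_left[of \<mu>] mult.left_commute[of \<mu> \<alpha>] cut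
    by (simp add: algebra_simps)
  also have "\<dots> = \<alpha> * lam * (b - v) * (u k + d k) - lam * (\<mu> * v) * d k"
    by (simp add: algebra_simps)
  also have "\<mu> * v = (\<alpha> + v) * (b - v)"
    using harmonic_identities(4) parameters(1) by (simp add: bv field_simps)
  also have "\<alpha> * lam * (b - v) * (u k + d k) - lam * ((\<alpha> + v) * (b - v)) * d k = lam * (lam / g) * F k"
    unfolding bv[symmetric] by (simp add: F_def algebra_simps)
  finally have "\<mu> * b * F (Suc k) = lam * (lam / g) * F k" .
  then have "F (Suc k) = lam\<^sup>2 / (\<mu> * b * g) * F k"
    using b pos parameters(1) by (simp add: field_simps power2_eq_square)
  then show ?case by (simp add: Suc.IH b_def)
qed simp

section \<open>Limits of the rescaled probabilities\<close>

lemma E_0_pos: "E 0 > 0"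
  using u_0_pos parameters by (simp add: E_def add_pos_nonneg)

lemma F_negligible: "(\<lambda>k. F k / g ^ k) \<longlonglongrightarrow> 0"
proof -
  define q where "q = lam\<^sup>2 / (\<mu> * (lam + \<beta>) * g)"
  have "0 < q" "q < g" using second_eigenvalue pos parameters(1) by (simp_all add: q_def)
  then have "(\<lambda>k. (q / g) ^ k * F 0) \<longlonglongrightarrow> 0"
    by (intro tendsto_mult_left_zero LIMSEQ_power_zero) simp
  then show ?thesis
    by (subst F_eq) (simp add: q_def[symmetric] power_divide)
qed

lemma u_tendsto: "(\<lambda>k. u k / g ^ k) \<longlonglongrightarrow> v * E 0 / D0"
  and d_tendsto: "(\<lambda>k. d k / g ^ k) \<longlonglongrightarrow> \<alpha> * E 0 / D0"
proof -
  have E: "E k / g ^ k = E 0" for k using E_eq[of k] parameters(1) by simp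
  \<comment> \<open>Cramer's rule for recovering \<open>u k\<close> and \<open>d k\<close> from
    \<open>E k\<close> and \<open>F k\<close>; the determinant is \<open>- D0\<close>.\<close>
  have "u k * D0 = v * E k + (r - g) * F k" "d k * D0 = \<alpha> * E k - (1 - g) * F k" for k
    by (simp_all add: E_def F_def D0_def algebra_simps)
  then have
    u: "u k / g ^ k = (v * E 0 + (r - g) * (F k / g ^ k)) / D0" and
    d: "d k / g ^ k = (\<alpha> * E 0 - (1 - g) * (F k / g ^ k)) / D0" for k
    unfolding E[of k, symmetric] using D0_pos parameters(1) by (simp_all add: field_simps)
  have "(\<lambda>k. (v * E 0 + (r - g) * (F k / g ^ k)) / D0) \<longlonglongrightarrow> (v * E 0 + (r - g) * 0) / D0"
    using D0_pos by (intro tendsto_intros F_negligible) simp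
  then show "(\<lambda>k. u k / g ^ k) \<longlonglongrightarrow> v * E 0 / D0" by (simp add: u)
  have "(\<lambda>k. (\<alpha> * E 0 - (1 - g) * (F k / g ^ k)) / D0) \<longlonglongrightarrow> (\<alpha> * E 0 - (1 - g) * 0) / D0"
    using D0_pos by (intro tendsto_intros F_negligible) simp
  then show "(\<lambda>k. d k / g ^ k) \<longlonglongrightarrow> \<alpha> * E 0 / D0" by (simp add: d)
qed

text \<open>The factor \<open>G1\<close> in \<open>eta1_div_d1\<close> cancels the one in
  \<open>C1\<close>, leaving the right eigenvector \<open>(v, \<alpha>)\<close> scaled by
  \<open>E 0 / D0\<close>.\<close>

lemma C1_eq:
  "C1 C lam \<mu> \<alpha> \<beta> \<pi> Up = v * E 0 / D0"
  "C1 C lam \<mu> \<alpha> \<beta> \<pi> Down = \<alpha> * E 0 / D0"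
proof -
  have "G1 lam \<mu> \<alpha> \<beta> > 0"
    using v_pos parameters pos by (simp add: G1_eq add_pos_pos)
  then show "C1 C lam \<mu> \<alpha> \<beta> \<pi> Up = v * E 0 / D0" "C1 C lam \<mu> \<alpha> \<beta> \<pi> Down = \<alpha> * E 0 / D0"
    by (simp_all add: C1_def eta1_div_d1 half_w v_def[symmetric] E_def[symmetric])
qed

end

lemma asymp_equiv_geometric:
  fixes f :: "nat \<Rightarrow> real"
  assumes "(\<lambda>k. f k / g ^ k) \<longlonglongrightarrow> a" "a \<noteq> 0"
  shows "f \<sim>[sequentially] (\<lambda>k. a * g ^ k)"
proof (rule asymp_equivI')
  have "(\<lambda>k. f k / g ^ k / a) \<longlonglongrightarrow> a / a"
    using assms by (intro tendsto_intros)
  then show "(\<lambda>k. f k / (a * g ^ k)) \<longlonglongrightarrow> 1"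
    using assms(2) by (simp add: mult.commute)
qed

theorem proposition2p1:
  fixes lam \<mu> \<alpha> \<beta> C :: real and \<pi> :: "(nat \<times> server) pmf"
  assumes "lam > 0" "\<mu> > 0" "\<alpha> > 0" "\<beta> > 0"
    and "lam < \<beta> / (\<alpha> + \<beta>) * \<mu>"
    and "C \<ge> lam + \<mu> + \<alpha> + \<beta>"
    and "stationary_distribution (rate lam \<mu> \<alpha> \<beta>) \<pi>"
  shows "(\<lambda>k. pmf \<pi> (k, Up)) \<sim>[sequentially]
             (\<lambda>k. C1 C lam \<mu> \<alpha> \<beta> \<pi> Up * gamma1 lam \<mu> \<alpha> \<beta> ^ k)
       \<and> (\<lambda>k. pmf \<pi> (k, Down)) \<sim>[sequentially]
             (\<lambda>k. C1 C lam \<mu> \<alpha> \<beta> \<pi> Down * gamma1 lam \<mu> \<alpha> \<beta> ^ k)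
       \<and> C1 C lam \<mu> \<alpha> \<beta> \<pi> Up \<noteq> 0
       \<and> C1 C lam \<mu> \<alpha> \<beta> \<pi> Down \<noteq> 0"
proof -
  interpret stationary_server lam \<mu> \<alpha> \<beta> C \<pi>
    using assms by unfold_locales
  have nz: "v * E 0 / D0 \<noteq> 0" "\<alpha> * E 0 / D0 \<noteq> 0"
    using v_pos E_0_pos D0_pos pos by auto
  show ?thesis
    using asymp_equiv_geometric[OF u_tendsto nz(1)] asymp_equiv_geometric[OF d_tendsto nz(2)] nz
    unfolding C1_eq g_def by blast
qed

end
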